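(* Let $G$ be a finite, simple, connected graph with at least one edge. Then $$\mathrm{Cl}(L(G))\simeq \mathrm{Cl}(G)^{(2)}.$$
   Context: $L(G)$ is the line graph of $G$: its vertices are the edges of $G$, two distinct ones being adjacent iff they share an endpoint. $\mathrm{Cl}(H)$ is the clique complex of a graph $H$: the simplicial complex on $V(H)$ whose simplices are the cliques of $H$. $K^{(2)}$ denotes the $2$-dimensional skeleton of a simplicial complex $K$, and $\simeq$ is homotopy equivalence. *)

theory Defs
  imports "HOL-Analysis.Analysis"
begin

record 'a sgraph =
  verts :: "'a set"
  edges :: "'a set set"

definition simple_graph :: "'a sgraph \<Rightarrow> bool" where
  "simple_graph G \<longleftrightarrow> (\<forall>e \<in> edges G. e \<subseteq> verts G \<and> card e = 2)"

definition finite_graph :: "'a sgraph \<Rightarrow> bool" where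
  "finite_graph G \<longleftrightarrow> finite (verts G)"

definition adjacent :: "'a sgraph \<Rightarrow> 'a \<Rightarrow> 'a \<Rightarrow> bool" where
  "adjacent G u v \<longleftrightarrow> {u, v} \<in> edges G"

definition connected_graph :: "'a sgraph \<Rightarrow> bool" where
  "connected_graph G \<longleftrightarrow> verts G \<noteq> {} \<and> (\<forall>u \<in> verts G. \<forall>v \<in> verts G. (adjacent G)\<^sup>*\<^sup>* u v)"

definition line_graph :: "'a sgraph \<Rightarrow> 'a set sgraph" where
  "line_graph G =
    \<lparr>verts = edges G,
     edges = {{e, f} | e f. e \<in> edges G \<and> f \<in> edges G \<and> e \<noteq> f \<and> e \<inter> f \<noteq> {}}\<rparr>"

(* Abstract simplicial complexes are represented by their sets of simplices,
   which are finite and nonempty; the empty set is not counted as a simplex. *)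

definition clique_complex :: "'a sgraph \<Rightarrow> 'a set set" where
  "clique_complex G =
    {s. s \<subseteq> verts G \<and> finite s \<and> s \<noteq> {} \<and> (\<forall>u \<in> s. \<forall>v \<in> s. u \<noteq> v \<longrightarrow> adjacent G u v)}"

(* An n-dimensional simplex has n + 1 vertices. *)
definition skeleton :: "nat \<Rightarrow> 'a set set \<Rightarrow> 'a set set" where
  "skeleton n K = {s \<in> K. card s \<le> n + 1}"

(* Geometric realization in barycentric coordinates: x v is the weight of the vertex v,
   and the vertices of nonzero weight must span a simplex. As a set of functions it carries
   the topology of pointwise convergence, which for a finite complex (the only case used)
   is the usual topology of the polyhedron. *)
definition realization :: "'a set set \<Rightarrow> ('a \<Rightarrow> real) set" where
  "realization K =
    {x. (\<forall>v. 0 \<le> x v) \<and> {v. x v \<noteq> 0} \<in> K \<and> (\<Sum>v | x v \<noteq> 0. x v) = 1}"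

lemma simple_graph_line_graph: "simple_graph (line_graph G)"
  unfolding simple_graph_def
proof
  fix d assume "d \<in> edges (line_graph G)"
  then obtain e f where "d = {e, f}" "e \<in> edges G" "f \<in> edges G" "e \<noteq> f"
    unfolding line_graph_def by auto
  then show "d \<subseteq> verts (line_graph G) \<and> card d = 2"
    by (simp add: line_graph_def)
qed

lemma clique_complex_down_closed:
  "s \<in> clique_complex G \<Longrightarrow> t \<subseteq> s \<Longrightarrow> t \<noteq> {} \<Longrightarrow> t \<in> clique_complex G"
  by (auto simp: clique_complex_def intro: finite_subset)

lemma skeleton_clique_complex_down_closed:
  assumes "s \<in> skeleton n (clique_complex G)" "t \<subseteq> s" "t \<noteq> {}"
  shows "t \<in> skeleton n (clique_complex G)"
proof -
  have "finite s" using assms(1) by (simp add: skeleton_def clique_complex_def)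
  then have "card t \<le> card s" using assms(2) by (rule card_mono)
  then show ?thesis
    using assms clique_complex_down_closed[of s G t] by (simp add: skeleton_def)
qed

end

theory Submission
  imports Defs
begin

text \<open>
  Each complex is mapped to the other by a majority rule. A weight \<open>x\<close> on the edges goes to
  the vertex weight proportional to the excess over \<open>1/2\<close> of the total weight of the edges at a
  vertex; a weight \<open>z\<close> on the vertices goes to the edge weight proportional to the excess over
  \<open>1/2\<close> of the total weight of the two endpoints. Two sets of weight more than \<open>1/2\<close> overlap
  inside the support, which makes the supports of the images cliques, and at most three vertices
  pass the threshold because the incidence weights of all vertices add up to \<open>2\<close>. On the line graph
  side the composite is not contiguous to the identity, but for both composites the support of the
  image meets the support of the point. This is enough: the normalised pointwise product of two such maps has its
  support contained in both, so it is joined to each of them by straight lines.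
\<close>

section \<open>Maps into a realization\<close>

definition sum_normalize :: "'b set \<Rightarrow> ('b \<Rightarrow> real) \<Rightarrow> 'b \<Rightarrow> real" where
  "sum_normalize W f = (\<lambda>w. f w / sum f W)"

locale finite_complex =
  fixes W :: "'b set" and K :: "'b set set"
  assumes finite_vertices: "finite W"
    and simplex_subset: "s \<in> K \<Longrightarrow> s \<subseteq> W"
    and face_closed: "s \<in> K \<Longrightarrow> t \<subseteq> s \<Longrightarrow> t \<noteq> {} \<Longrightarrow> t \<in> K"
begin

text \<open>Coordinates outside the support contribute zero, so the sum over the support, which
  varies with the point, becomes a sum over the fixed finite set \<open>W\<close>. Totals of
  different points can then be added and compared termwise.\<close>

lemma realization_iff:
  "x \<in> realization K \<longleftrightarrow> (\<forall>v. 0 \<le> x v) \<and> {v. x v \<noteq> 0} \<in> K \<and> sum x W = 1"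
proof -
  have "sum x {v. x v \<noteq> 0} = sum x W" if "{v. x v \<noteq> 0} \<in> K"
    using simplex_subset[OF that] finite_vertices by (intro sum.mono_neutral_left) auto
  then show ?thesis
    by (auto simp: realization_def)
qed

lemma realizationD:
  assumes "x \<in> realization K"
  shows "0 \<le> x v" "{v. 0 < x v} \<in> K" "sum x W = 1" "0 < x v \<Longrightarrow> v \<in> W"
proof -
  have "{v. x v \<noteq> 0} = {v. 0 < x v}"
    using assms by (auto simp: realization_iff less_le)
  then show "0 \<le> x v" "{v. 0 < x v} \<in> K" "sum x W = 1"
    using assms by (auto simp: realization_iff)
  then show "0 < x v \<Longrightarrow> v \<in> W"
    using simplex_subset by blast
qed

lemma realization_support_nonempty:
  assumes "x \<in> realization K"
  obtains v where "0 < x v"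
proof -
  have "sum x W \<noteq> 0"
    using realizationD(3)[OF assms] by simp
  then obtain v where "x v \<noteq> 0"
    by (metis sum.neutral)
  with realizationD(1)[OF assms, of v] that[of v] show thesis
    by simp
qed

lemma sum_normalize_in_realization:
  assumes nonneg: "\<And>w. 0 \<le> f w" and supp: "{w. 0 < f w} \<in> K" "{w. 0 < f w} \<noteq> {}"
  shows "sum_normalize W f \<in> realization K"
proof -
  have "0 < sum f W"
  proof -
    obtain w where "0 < f w" "w \<in> W"
      using supp simplex_subset by blast
    then show ?thesis
      using nonneg finite_vertices by (intro sum_pos2[of W w]) auto
  qed
  moreover have "{w. f w \<noteq> 0} = {w. 0 < f w}"
    using nonneg by (auto simp: less_le)
  ultimately show ?thesis
    using nonneg supp by (auto simp: realization_iff sum_normalize_def simp flip: sum_divide_distrib)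
qed

lemma continuous_on_sum_normalize:
  assumes "\<And>w. continuous_on S (\<lambda>p. f p w)" "\<And>p. p \<in> S \<Longrightarrow> sum (f p) W \<noteq> 0"
  shows "continuous_on S (\<lambda>p. sum_normalize W (f p))"
  unfolding sum_normalize_def
  by (intro continuous_on_coordinatewise_then_product continuous_on_divide continuous_on_sum) (use assms in auto)

text \<open>The straight-line homotopy stays in the complex: each convex combination of
  \<open>f p\<close> and \<open>g p\<close> has its support inside that of \<open>g p\<close>, hence
  on a face of a simplex.\<close>

lemma homotopic_if_support_subset:
  assumes f: "continuous_on S f" "f ` S \<subseteq> realization K"
    and g: "continuous_on S g" "g ` S \<subseteq> realization K"
    and supp: "\<And>p v. p \<in> S \<Longrightarrow> 0 < f p v \<Longrightarrow> 0 < g p v"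
  shows "homotopic_with_canon (\<lambda>_. True) S (realization K) f g"
proof -
  define h where "h = (\<lambda>(t::real, p) v. (1 - t) * f p v + t * g p v)"
  have "continuous_on ({0..1} \<times> S) (\<lambda>q. f (snd q) v)" "continuous_on ({0..1} \<times> S) (\<lambda>q. g (snd q) v)" for v
    by (rule continuous_on_compose2[OF continuous_on_product_then_coordinatewise[OF f(1)] continuous_on_snd[OF continuous_on_id]]
        continuous_on_compose2[OF continuous_on_product_then_coordinatewise[OF g(1)] continuous_on_snd[OF continuous_on_id]]; auto)+
  then have "continuous_on ({0..1} \<times> S) h"
    unfolding h_def case_prod_beta
    by (intro continuous_intros)
  moreover have "h (t, p) \<in> realization K" if t: "t \<in> {0..1}" and p: "p \<in> S" for t p
  proof -
    have fp: "f p \<in> realization K" and gp: "g p \<in> realization K"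
      using f g p by auto
    note F = realizationD[OF fp] and G = realizationD[OF gp]
    have nonneg: "0 \<le> h (t, p) v" for v
      using t F(1) G(1) by (auto simp: h_def)
    have total: "sum (h (t, p)) W = 1"
      using F(3) G(3) by (simp add: h_def sum.distrib flip: sum_distrib_left)
    have "{v. h (t, p) v \<noteq> 0} \<subseteq> {v. 0 < g p v}"
      using supp[OF p] F(1) G(1) by (auto simp: h_def less_le)
    moreover have "{v. h (t, p) v \<noteq> 0} \<noteq> {}"
      using total by (auto intro: ccontr)
    ultimately show ?thesis
      using nonneg total face_closed[OF G(2)] by (auto simp: realization_iff)
  qed
  ultimately have "continuous_map (prod_topology (top_of_set {0..1}) (top_of_set S)) (top_of_set (realization K)) h"
    by auto
  then show ?thesis
    unfolding homotopic_with_def by (intro exI[of _ h]) (auto simp: h_def)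
qed

text \<open>The segment from \<open>f p\<close> to \<open>g p\<close> may leave the complex, since
  the two supports need not lie in a common simplex. The detour through \<open>r p\<close> has the
  intersection of the supports as its support, and \<open>meet\<close> keeps the normalising total
  positive.\<close>

lemma homotopic_if_supports_meet:
  assumes f: "continuous_on S f" "f ` S \<subseteq> realization K"
    and g: "continuous_on S g" "g ` S \<subseteq> realization K"
    and meet: "\<And>p. p \<in> S \<Longrightarrow> \<exists>v. 0 < f p v \<and> 0 < g p v"
  shows "homotopic_with_canon (\<lambda>_. True) S (realization K) f g"
proof -
  define fg where "fg = (\<lambda>p v. f p v * g p v)"
  define r where "r = (\<lambda>p. sum_normalize W (fg p))"
  have mem: "f p \<in> realization K" "g p \<in> realization K" if "p \<in> S" for p
    using f g that by auto
  have nonneg: "0 \<le> fg p v" if "p \<in> S" for p v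
    using mem[OF that] realizationD(1) by (auto simp: fg_def)
  have supp: "0 < f p v \<and> 0 < g p v" if "p \<in> S" "0 < fg p v" for p v
    using that(2) realizationD(1)[OF mem(1)[OF that(1)], of v] realizationD(1)[OF mem(2)[OF that(1)], of v]
    by (auto simp: fg_def zero_less_mult_iff)
  have pos: "0 < sum (fg p) W" if p: "p \<in> S" for p
  proof -
    obtain v where v: "0 < f p v" "0 < g p v"
      using meet[OF p] by blast
    show ?thesis
      using v realizationD(4)[OF mem(1)[OF p] v(1)] finite_vertices nonneg[OF p]
      by (intro sum_pos2[of W v]) (auto simp: fg_def)
  qed
  have r_in: "r ` S \<subseteq> realization K"
  proof safe
    fix p assume p: "p \<in> S"
    have "\<exists>v. 0 < fg p v"
      using meet[OF p] unfolding fg_def by (meson mult_pos_pos)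
    then have "{v. 0 < fg p v} \<noteq> {}"
      by blast
    moreover have "{v. 0 < fg p v} \<subseteq> {v. 0 < f p v}"
      using supp[OF p] by auto
    ultimately show "r p \<in> realization K"
      unfolding r_def
      using nonneg[OF p] face_closed[OF realizationD(2)[OF mem(1)[OF p]]]
      by (intro sum_normalize_in_realization) auto
  qed
  have r_cont: "continuous_on S r"
    unfolding r_def
  proof (rule continuous_on_sum_normalize)
    show "continuous_on S (\<lambda>p. fg p v)" for v
      unfolding fg_def using f(1) g(1)
      by (intro continuous_on_mult) (auto intro: continuous_on_product_then_coordinatewise)
    show "sum (fg p) W \<noteq> 0" if "p \<in> S" for p
      using pos[OF that] by simp
  qed
  have r_supp: "0 < f p v \<and> 0 < g p v" if "p \<in> S" "0 < r p v" for p v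
  proof -
    have "0 < fg p v"
      using that pos[OF that(1)] by (simp add: r_def sum_normalize_def zero_less_divide_iff)
    with supp that(1) show ?thesis .
  qed
  have "homotopic_with_canon (\<lambda>_. True) S (realization K) r f"
    using homotopic_if_support_subset[OF r_cont r_in f] r_supp by blast
  moreover have "homotopic_with_canon (\<lambda>_. True) S (realization K) r g"
    using homotopic_if_support_subset[OF r_cont r_in g] r_supp by blast
  ultimately show ?thesis
    using homotopic_with_symD homotopic_with_trans by blast
qed

end

section \<open>The majority map\<close>

text \<open>\<open>N w\<close> is the set of source vertices that count for \<open>w\<close>: a star
  if \<open>w\<close> is a vertex, its two endpoints if \<open>w\<close> is an edge. Truncating at 0
  keeps the value continuous in \<open>x\<close>, unlike an indicator of majority. The value 0 off
  \<open>W\<close> matters in the second case, where sets that are not edges may also carry more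
  than half of the weight.\<close>

definition excess :: "'b set \<Rightarrow> ('b \<Rightarrow> 'a set) \<Rightarrow> ('a \<Rightarrow> real) \<Rightarrow> 'b \<Rightarrow> real" where
  "excess W N x w = (if w \<in> W then max 0 (sum x (N w) - 1/2) else 0)"

definition majority :: "'b set \<Rightarrow> ('b \<Rightarrow> 'a set) \<Rightarrow> ('a \<Rightarrow> real) \<Rightarrow> 'b \<Rightarrow> real" where
  "majority W N x = sum_normalize W (excess W N x)"

lemma excess_nonneg: "0 \<le> excess W N x w"
  by (simp add: excess_def)

lemma excess_pos_iff: "0 < excess W N x w \<longleftrightarrow> w \<in> W \<and> 1/2 < sum x (N w)"
  by (auto simp: excess_def)

text \<open>This holds for every \<open>x\<close>: if no \<open>w\<close> has a majority, all
  excesses are 0 and division by the zero total gives 0 again.\<close>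

lemma majority_pos_iff:
  assumes "finite W"
  shows "0 < majority W N x w \<longleftrightarrow> w \<in> W \<and> 1/2 < sum x (N w)"
proof -
  have "0 < sum (excess W N x) W" if "0 < excess W N x w"
    using that assms by (intro sum_pos2[of W w]) (auto simp: excess_nonneg excess_pos_iff)
  moreover have "0 \<le> sum (excess W N x) W"
    by (simp add: excess_nonneg sum_nonneg)
  ultimately show ?thesis
    unfolding majority_def sum_normalize_def excess_pos_iff[symmetric]
    using excess_nonneg[of W N x w] by (auto simp: zero_less_divide_iff)
qed

context finite_complex
begin

lemma majority_in_realization:
  assumes "{w \<in> W. 1/2 < sum x (N w)} \<in> K" "\<exists>w \<in> W. 1/2 < sum x (N w)"
  shows "majority W N x \<in> realization K"
  unfolding majority_def using assms
  by (intro sum_normalize_in_realization) (auto simp: excess_pos_iff excess_nonneg)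

lemma continuous_on_majority:
  assumes "\<And>x. x \<in> S \<Longrightarrow> \<exists>w \<in> W. 1/2 < sum x (N w)"
  shows "continuous_on S (majority W N)"
  unfolding majority_def
proof (rule continuous_on_sum_normalize)
  have *: "continuous_on S (\<lambda>x. x i)" for i
    by (rule continuous_on_product_then_coordinatewise[OF continuous_on_id])
  show "continuous_on S (\<lambda>x. excess W N x w)" for w
    unfolding excess_def
    by (cases "w \<in> W") (auto intro!: continuous_intros *)
  show "sum (excess W N x) W \<noteq> 0" if x: "x \<in> S" for x
  proof -
    obtain w where "w \<in> W" "0 < excess W N x w"
      using assms[OF x] excess_pos_iff by metis
    then have "0 < sum (excess W N x) W"
      using finite_vertices by (intro sum_pos2[of W w]) (auto simp: excess_nonneg)
    then show ?thesis by simp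
  qed
qed

text \<open>Inclusion-exclusion: the union weighs at most 1, so the intersection has positive
  weight.\<close>

lemma overlap_of_majorities:
  assumes x: "x \<in> realization K" and "A \<subseteq> W" "B \<subseteq> W" "1 < sum x A + sum x B"
  obtains w where "w \<in> A" "w \<in> B" "0 < x w"
proof -
  have fin: "finite A" "finite B"
    using assms finite_vertices finite_subset by auto
  have "sum x (A \<union> B) \<le> 1"
    using assms finite_vertices realizationD(1,3)[OF x] sum_mono2[of W "A \<union> B" x] by simp
  then have "sum x (A \<inter> B) \<noteq> 0"
    using sum_Un[OF fin, of x] assms(4) by linarith
  then obtain w where "w \<in> A \<inter> B" "x w \<noteq> 0"
    by (metis sum.neutral)
  with realizationD(1)[OF x, of w] that[of w] show thesis
    by auto
qed

text \<open>Dimension two is essential here. For three vertices the pair sums add up to 2, so one of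
  them is at least 2/3, whereas four equal weights give exactly 1/2 for every pair. A single vertex
  is covered by taking \<open>u = v\<close>.\<close>

lemma majority_pair:
  assumes x: "x \<in> realization K" and card: "card {v. 0 < x v} \<le> 3"
  obtains u v where "0 < x u" "0 < x v" "1/2 < sum x {u, v}"
proof -
  define T where "T = {v. 0 < x v}"
  have "T \<subseteq> W"
    using realizationD(4)[OF x] by (auto simp: T_def)
  then have fin: "finite T"
    using finite_vertices finite_subset by blast
  have "sum x T = sum x W"
    using \<open>T \<subseteq> W\<close> finite_vertices realizationD(1)[OF x]
    by (intro sum.mono_neutral_left) (auto simp: T_def less_le)
  then have total: "sum x T = 1"
    using realizationD(3)[OF x] by simp
  have "T \<noteq> {}"
    using total by auto
  then have "card T = 1 \<or> card T = 2 \<or> card T = 3"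
    using card fin card_gt_0_iff[of T] unfolding T_def[symmetric] by linarith
  then consider u where "T = {u}" | u v where "T = {u, v}"
    | u v w where "T = {u, v, w}" "u \<noteq> v" "v \<noteq> w" "u \<noteq> w"
    by (auto simp: card_1_singleton_iff card_2_iff card_3_iff)
  then show thesis
  proof cases
    case 1
    then show thesis using that[of u u] total by (auto simp: T_def)
  next
    case 2
    then show thesis using that[of u v] total by (auto simp: T_def)
  next
    case 3
    have mem: "0 < x u" "0 < x v" "0 < x w"
      using 3 by (auto simp: T_def)
    have "x u + x v + x w = 1"
      using total 3 by simp
    then have "1/2 < x u + x v \<or> 1/2 < x v + x w \<or> 1/2 < x u + x w"
      by linarith
    then show thesis
      using that[of u v] that[of v w] that[of u w] mem 3 by auto
  qed
qed

end

section \<open>The two majority maps of a graph\<close>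

locale nonempty_connected_graph =
  fixes G :: "'a sgraph"
  assumes finite_graph: "finite_graph G"
    and simple_graph: "simple_graph G"
    and connected_graph: "connected_graph G"
    and edges_nonempty: "edges G \<noteq> {}"
begin

abbreviation V where "V \<equiv> verts G"
abbreviation E where "E \<equiv> edges G"
abbreviation star where "star v \<equiv> {e \<in> E. v \<in> e}"
abbreviation L where "L \<equiv> clique_complex (line_graph G)"
abbreviation C where "C \<equiv> skeleton 2 (clique_complex G)"
abbreviation to_verts where "to_verts \<equiv> majority V star"
abbreviation to_edges where "to_edges \<equiv> majority E (\<lambda>e. e)"

section \<open>Simplices of the two complexes in terms of edges\<close>

lemma edge_subset: "e \<in> E \<Longrightarrow> e \<subseteq> V"
  and edge_card: "e \<in> E \<Longrightarrow> card e = 2"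
  using simple_graph by (auto simp: simple_graph_def)

lemma finite_verts: "finite V"
  using finite_graph by (simp add: finite_graph_def)

lemma finite_edges: "finite E"
  using finite_verts edge_subset finite_subset[of E "Pow V"] by auto

lemma edge_eqI:
  assumes "e \<in> E" "a \<in> e" "b \<in> e" "a \<noteq> b"
  shows "e = {a, b}"
proof -
  have "finite e"
    using assms(1) edge_subset finite_verts finite_subset by metis
  then have "{a, b} = e"
    using assms edge_card[OF assms(1)] by (intro card_seteq) simp_all
  then show ?thesis by simp
qed

lemma adjacent_line_graph_iff:
  "adjacent (line_graph G) e f \<longleftrightarrow> e \<in> E \<and> f \<in> E \<and> e \<noteq> f \<and> e \<inter> f \<noteq> {}"
  by (auto simp: adjacent_def line_graph_def doubleton_eq_iff)

text \<open>Every edge meets itself, so the distinctness condition drops out and the simplices are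
  the nonempty intersecting families of edges.\<close>

lemma mem_line_clique_iff:
  "s \<in> L \<longleftrightarrow> s \<subseteq> E \<and> s \<noteq> {} \<and> (\<forall>e \<in> s. \<forall>f \<in> s. e \<inter> f \<noteq> {})"
proof -
  have self: "e \<inter> e \<noteq> {}" if "e \<in> E" for e
    using edge_card[OF that] by auto
  have "s \<in> L \<longleftrightarrow> s \<subseteq> E \<and> s \<noteq> {} \<and> (\<forall>e \<in> s. \<forall>f \<in> s. e \<noteq> f \<longrightarrow> adjacent (line_graph G) e f)"
    using finite_subset[OF _ finite_edges, of s] by (auto simp: clique_complex_def line_graph_def)
  then show ?thesis
    unfolding adjacent_line_graph_iff using self by (metis subsetD)
qed

lemma line_clique_meet: "s \<in> L \<Longrightarrow> e \<in> s \<Longrightarrow> f \<in> s \<Longrightarrow> e \<inter> f \<noteq> {}"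
  unfolding mem_line_clique_iff by simp

lemma mem_skeleton_iff:
  "s \<in> C \<longleftrightarrow> s \<subseteq> V \<and> s \<noteq> {} \<and> card s \<le> 3 \<and> (\<forall>u \<in> s. \<forall>v \<in> s. u \<noteq> v \<longrightarrow> {u, v} \<in> E)"
  using finite_subset[OF _ finite_verts, of s]
  by (auto simp: skeleton_def clique_complex_def adjacent_def)

sublocale L: finite_complex E L
proof unfold_locales
  show "t \<in> L" if "s \<in> L" "t \<subseteq> s" "t \<noteq> {}" for s t
    using that by (rule clique_complex_down_closed)
qed (simp_all add: finite_edges mem_line_clique_iff)

sublocale C: finite_complex V C
proof unfold_locales
  show "t \<in> C" if "s \<in> C" "t \<subseteq> s" "t \<noteq> {}" for s t
    using that by (rule skeleton_clique_complex_down_closed)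
qed (auto simp: finite_verts mem_skeleton_iff)

text \<open>Connectedness and the existence of an edge enter here: no vertex is isolated. An
  isolated vertex would be a point of the clique complex at which no edge has a majority.\<close>

lemma incident_edge:
  assumes "v \<in> V"
  obtains e where "e \<in> E" "v \<in> e"
proof -
  obtain e where e: "e \<in> E"
    using edges_nonempty by blast
  then obtain a b where ab: "e = {a, b}" "a \<noteq> b"
    using edge_card card_2_iff by metis
  show thesis
  proof (cases "v = a")
    case True
    then show thesis using that e ab by blast
  next
    case False
    have "a \<in> V"
      using edge_subset[OF e] ab by auto
    then have "(adjacent G)\<^sup>*\<^sup>* v a"
      using connected_graph assms by (auto simp: connected_graph_def)
    then obtain u where "adjacent G v u"
      using False by (auto elim: converse_rtranclpE)
    then show thesis
      using that by (auto simp: adjacent_def)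
  qed
qed

section \<open>From edge weights to vertex weights\<close>

lemma star_sums_edge:
  assumes x: "x \<in> realization L" and e: "0 < x {a, b}" "a \<noteq> b"
  shows "sum x (star a) + sum x (star b) = 1 + x {a, b}"
proof -
  have ab: "{a, b} \<in> E"
    using L.realizationD(4)[OF x e(1)] .
  have fin: "finite (star v)" for v
    using finite_edges by simp
  have inter: "star a \<inter> star b = {{a, b}}"
    using ab edge_eqI[OF _ _ _ e(2)] by blast
  \<comment> \<open>Edges in the support pairwise meet, so all the weight lies on edges at
    \<open>a\<close> or \<open>b\<close>. Inclusion-exclusion then counts only \<open>{a, b}\<close>
    twice.\<close>
  have "x f = 0" if "f \<in> E - (star a \<union> star b)" for f
  proof (rule ccontr)
    assume "x f \<noteq> 0"
    then have "0 < x f"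
      using L.realizationD(1)[OF x, of f] by linarith
    then have "{a, b} \<inter> f \<noteq> {}"
      using line_clique_meet[OF L.realizationD(2)[OF x]] e(1) by (simp del: disjoint_insert insert_disjoint Int_insert_left)
    with that show False by auto
  qed
  then have "sum x (star a \<union> star b) = sum x E"
    using finite_edges by (intro sum.mono_neutral_left) auto
  then have "sum x (star a \<union> star b) = 1"
    using L.realizationD(3)[OF x] by simp
  then show ?thesis
    using sum_Un[OF fin fin, of x a b] by (simp add: inter)
qed

text \<open>The star sums of the two endpoints exceed 1 together, the surplus being the weight of
  \<open>e\<close>, so one of them exceeds 1/2. The endpoints are named so that \<open>a\<close> is
  that one.\<close>

lemma majority_endpoint:
  assumes x: "x \<in> realization L" and e: "0 < x e"
  obtains a b where "e = {a, b}" "a \<in> V" "1/2 < sum x (star a)"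
proof -
  have "e \<in> E"
    using L.realizationD(4)[OF x e] .
  then obtain a b where ab: "e = {a, b}" "a \<noteq> b"
    using edge_card card_2_iff by metis
  have V: "a \<in> V" "b \<in> V"
    using edge_subset[OF \<open>e \<in> E\<close>] ab by auto
  have "1 < sum x (star a) + sum x (star b)"
    using star_sums_edge[OF x] e ab by simp
  then have "1/2 < sum x (star a) \<or> 1/2 < sum x (star b)"
    by linarith
  then show thesis
    using that[of a b] that[of b a] ab V by (auto simp: insert_commute)
qed

lemma to_verts_pos_iff: "0 < to_verts x v \<longleftrightarrow> v \<in> V \<and> 1/2 < sum x (star v)"
  by (rule majority_pos_iff[OF finite_verts])

lemma to_edges_pos_iff: "0 < to_edges z e \<longleftrightarrow> e \<in> E \<and> 1/2 < sum z e"
  by (rule majority_pos_iff[OF finite_edges])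

text \<open>The two stars overlap inside the support. The case \<open>u = v\<close> is included
  because the pair from \<open>majority_pair\<close> may degenerate.\<close>

lemma edge_through_majority_vertices:
  assumes x: "x \<in> realization L" and "1/2 < sum x (star u)" "1/2 < sum x (star v)"
  obtains e where "e \<in> E" "u \<in> e" "v \<in> e" "0 < x e"
proof -
  have "1 < sum x (star u) + sum x (star v)"
    using assms(2,3) by linarith
  then obtain e where "e \<in> star u" "e \<in> star v" "0 < x e"
    using L.overlap_of_majorities[OF x, of "star u" "star v"] by blast
  with that[of e] show thesis by simp
qed

text \<open>A weighted handshake lemma: after exchanging the sums, each edge is counted once for
  each of its endpoints in \<open>S\<close>.\<close>

lemma sum_stars_le:
  assumes x: "x \<in> realization L" and "finite S"
  shows "(\<Sum>v\<in>S. sum x (star v)) \<le> 2"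
proof -
  have "(\<Sum>v\<in>S. sum x (star v)) = (\<Sum>v\<in>S. \<Sum>e\<in>E. if v \<in> e then x e else 0)"
    using finite_edges by (simp add: sum.inter_filter)
  also have "\<dots> = (\<Sum>e\<in>E. \<Sum>v\<in>S. if v \<in> e then x e else 0)"
    by (rule sum.swap)
  also have "\<dots> = (\<Sum>e\<in>E. card {v \<in> S. v \<in> e} * x e)"
    using assms(2) by (simp flip: sum.inter_filter)
  also have "\<dots> \<le> (\<Sum>e\<in>E. 2 * x e)"
  proof (rule sum_mono)
    fix e assume e: "e \<in> E"
    have "finite e"
      using e edge_subset finite_verts finite_subset by blast
    then have "card {v \<in> S. v \<in> e} \<le> 2"
      using card_mono[of e "{v \<in> S. v \<in> e}"] edge_card[OF e] by auto
    then show "card {v \<in> S. v \<in> e} * x e \<le> 2 * x e"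
      using L.realizationD(1)[OF x, of e] by (intro mult_right_mono) auto
  qed
  also have "\<dots> = 2"
    using L.realizationD(3)[OF x] by (simp flip: sum_distrib_left)
  finally show ?thesis .
qed

lemma majority_vertex_exists:
  assumes x: "x \<in> realization L"
  shows "\<exists>v \<in> V. 1/2 < sum x (star v)"
proof -
  obtain e where "0 < x e"
    using L.realization_support_nonempty[OF x] .
  then show ?thesis
    using majority_endpoint[OF x] by metis
qed

lemma majority_vertices_simplex:
  assumes x: "x \<in> realization L"
  shows "{v \<in> V. 1/2 < sum x (star v)} \<in> C" (is "?S \<in> C")
proof -
  have fin: "finite ?S"
    using finite_verts by simp
  have ne: "?S \<noteq> {}"
    using majority_vertex_exists[OF x] by blast
  \<comment> \<open>Each majority is strict and the set is nonempty, so half its cardinality is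
    strictly below 2. Strictness excludes a fourth vertex.\<close>
  have "(\<Sum>v\<in>?S. 1/2) < (\<Sum>v\<in>?S. sum x (star v))"
    using fin ne by (intro sum_strict_mono) auto
  also have "\<dots> \<le> 2"
    using sum_stars_le[OF x fin] .
  finally have "card ?S \<le> 3"
    by simp
  moreover have "{u, v} \<in> E" if uv: "u \<in> ?S" "v \<in> ?S" "u \<noteq> v" for u v
  proof -
    obtain e where e: "e \<in> E" "u \<in> e" "v \<in> e"
      using edge_through_majority_vertices[OF x] uv(1,2) by blast
    then have "e = {u, v}"
      using edge_eqI uv(3) by simp
    then show ?thesis using e by simp
  qed
  ultimately show ?thesis
    unfolding mem_skeleton_iff using ne by auto
qed

section \<open>From vertex weights to edge weights\<close>

lemma edge_containing_pair:
  assumes z: "z \<in> realization C" and uv: "0 < z u" "0 < z v"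
  obtains e where "e \<in> E" "{u, v} \<subseteq> e"
proof (cases "u = v")
  case True
  then show thesis
    using incident_edge[OF C.realizationD(4)[OF z uv(1)]] that by auto
next
  case False
  then have "{u, v} \<in> E"
    using C.realizationD(2)[OF z] uv unfolding mem_skeleton_iff by auto
  then show thesis using that by blast
qed

lemma sum_edge_ge:
  assumes z: "z \<in> realization C" and "e \<in> E" "A \<subseteq> e"
  shows "sum z A \<le> sum z e"
  using assms edge_subset finite_verts C.realizationD(1)[OF z]
  by (intro sum_mono2) (auto intro: finite_subset)

text \<open>At most three vertices carry weight, so some pair has a majority; it extends to an edge
  even when it is a single vertex, and the extension loses no weight.\<close>

lemma majority_edge_exists:
  assumes z: "z \<in> realization C"
  shows "\<exists>e \<in> E. 1/2 < sum z e"
proof -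
  have "card {v. 0 < z v} \<le> 3"
    using C.realizationD(2)[OF z] unfolding mem_skeleton_iff by blast
  then obtain u v where uv: "0 < z u" "0 < z v" "1/2 < sum z {u, v}"
    using C.majority_pair[OF z] by blast
  then obtain e where e: "e \<in> E" "{u, v} \<subseteq> e"
    using edge_containing_pair[OF z] by blast
  then show ?thesis
    using uv(3) sum_edge_ge[OF z e] e(1) by (intro bexI[of _ e]) linarith+
qed

lemma majority_edges_simplex:
  assumes z: "z \<in> realization C"
  shows "{e \<in> E. 1/2 < sum z e} \<in> L"
proof -
  have "e \<inter> f \<noteq> {}" if ef: "e \<in> E" "f \<in> E" "1/2 < sum z e" "1/2 < sum z f" for e f
  proof -
    have "1 < sum z e + sum z f"
      using ef(3,4) by linarith
    then obtain v where "v \<in> e" "v \<in> f"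
      using C.overlap_of_majorities[OF z, of e f] edge_subset ef(1,2) by metis
    then show ?thesis by blast
  qed
  moreover have "{e \<in> E. 1/2 < sum z e} \<noteq> {}"
    using majority_edge_exists[OF z] by blast
  ultimately show ?thesis
    unfolding mem_line_clique_iff by simp
qed

section \<open>The two maps and their composites\<close>

lemma to_verts_in_realization: "x \<in> realization L \<Longrightarrow> to_verts x \<in> realization C"
  using majority_vertices_simplex majority_vertex_exists
  by (intro C.majority_in_realization) auto

lemma to_edges_in_realization: "z \<in> realization C \<Longrightarrow> to_edges z \<in> realization L"
  using majority_edges_simplex majority_edge_exists
  by (intro L.majority_in_realization) auto

lemma continuous_on_to_verts: "continuous_on (realization L) to_verts"
  using majority_vertex_exists by (intro C.continuous_on_majority) auto

lemma continuous_on_to_edges: "continuous_on (realization C) to_edges"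
  using majority_edge_exists by (intro L.continuous_on_majority) auto

text \<open>Take a majority pair of \<open>to_verts x\<close>. Both of its stars are majorities for
  \<open>x\<close>, so they share an edge of positive weight. That edge contains the pair and hence
  has a majority for \<open>to_verts x\<close>.\<close>

lemma to_edges_to_verts_meets:
  assumes x: "x \<in> realization L"
  shows "\<exists>e. 0 < to_edges (to_verts x) e \<and> 0 < x e"
proof -
  note y = to_verts_in_realization[OF x]
  have "card {v. 0 < to_verts x v} \<le> 3"
    using C.realizationD(2)[OF y] unfolding mem_skeleton_iff by blast
  then obtain u v where uv: "0 < to_verts x u" "0 < to_verts x v" "1/2 < sum (to_verts x) {u, v}"
    using C.majority_pair[OF y] by blast
  then have "1/2 < sum x (star u)" "1/2 < sum x (star v)"
    unfolding to_verts_pos_iff by blast+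
  then obtain e where e: "e \<in> E" "u \<in> e" "v \<in> e" "0 < x e"
    using edge_through_majority_vertices[OF x] by blast
  then have "1/2 < sum (to_verts x) e"
    using uv(3) sum_edge_ge[OF y e(1), of "{u, v}"] by simp
  then show ?thesis
    using e by (auto simp: to_edges_pos_iff)
qed

text \<open>An endpoint \<open>a\<close> with a majority star lies in the support of the image but
  may have weight 0 in \<open>z\<close>. In that case the other endpoint \<open>b\<close> of the
  edge serves: it holds more than half of \<open>z\<close>, and its star has total weight 1.\<close>

lemma to_verts_to_edges_meets:
  assumes z: "z \<in> realization C"
  shows "\<exists>v. 0 < to_verts (to_edges z) v \<and> 0 < z v"
proof -
  note w = to_edges_in_realization[OF z]
  obtain e where e: "0 < to_edges z e"
    using L.realization_support_nonempty[OF w] .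
  obtain a b where ab: "e = {a, b}" "a \<in> V" "1/2 < sum (to_edges z) (star a)"
    using majority_endpoint[OF w e] .
  show ?thesis
  proof (cases "0 < z a")
    case True
    then show ?thesis using ab by (auto simp: to_verts_pos_iff)
  next
    case False
    then have za: "z a = 0"
      using C.realizationD(1)[OF z, of a] by linarith
    have eE: "e \<in> E" "1/2 < sum z e"
      using e by (auto simp: to_edges_pos_iff)
    \<comment> \<open>\<open>majority_endpoint\<close> does not record that \<open>a\<close> and
      \<open>b\<close> differ. If they coincided, \<open>e\<close> would weigh
      \<open>z a = 0\<close>, contradicting its majority.\<close>
    then have zb: "1/2 < z b" and b: "b \<in> V"
      using ab(1) za edge_subset[of e] by (cases "a = b"; auto)+
    \<comment> \<open>The vertex \<open>b\<close> alone carries a majority, so every edge in the support contains it.\<close>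
    have "to_edges z f = 0" if "f \<in> E - star b" for f
    proof (rule ccontr)
      assume "to_edges z f \<noteq> 0"
      then have "0 < to_edges z f"
        using L.realizationD(1)[OF w, of f] by linarith
      then have f: "f \<in> E" "1/2 < sum z f"
        by (auto simp: to_edges_pos_iff)
      have "1 < sum z {b} + sum z f"
        using zb f(2) by simp
      then obtain c where "c \<in> {b}" "c \<in> f"
        using C.overlap_of_majorities[OF z, of "{b}" f] b edge_subset[OF f(1)] by blast
      then show False using that by simp
    qed
    then have "sum (to_edges z) (star b) = sum (to_edges z) E"
      using finite_edges by (intro sum.mono_neutral_left) auto
    then have "0 < to_verts (to_edges z) b"
      using L.realizationD(3)[OF w] b by (simp add: to_verts_pos_iff)
    moreover have "0 < z b"
      using zb by simp
    ultimately show ?thesis by blast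
  qed
qed

lemma realizations_homotopy_eqv: "realization L homotopy_eqv realization C"
  unfolding homotopy_equivalent_space_def
proof (intro exI conjI)
  have v: "to_verts ` realization L \<subseteq> realization C" and e: "to_edges ` realization C \<subseteq> realization L"
    using to_verts_in_realization to_edges_in_realization by auto
  show "continuous_map (top_of_set (realization L)) (top_of_set (realization C)) to_verts"
    using continuous_on_to_verts v by auto
  show "continuous_map (top_of_set (realization C)) (top_of_set (realization L)) to_edges"
    using continuous_on_to_edges e by auto
  show "homotopic_with_canon (\<lambda>_. True) (realization L) (realization L) (to_edges \<circ> to_verts) id"
  proof (rule L.homotopic_if_supports_meet)
    show "continuous_on (realization L) (to_edges \<circ> to_verts)"
      by (rule continuous_on_compose[OF continuous_on_to_verts continuous_on_subset[OF continuous_on_to_edges v]])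
    show "(to_edges \<circ> to_verts) ` realization L \<subseteq> realization L"
      using v e by fastforce
    show "\<exists>v. 0 < (to_edges \<circ> to_verts) p v \<and> 0 < id p v" if "p \<in> realization L" for p
      using to_edges_to_verts_meets[OF that] by (simp only: o_apply id_apply)
  qed (simp_all only: image_id id_apply subset_refl continuous_on_id')
  show "homotopic_with_canon (\<lambda>_. True) (realization C) (realization C) (to_verts \<circ> to_edges) id"
  proof (rule C.homotopic_if_supports_meet)
    show "continuous_on (realization C) (to_verts \<circ> to_edges)"
      by (rule continuous_on_compose[OF continuous_on_to_edges continuous_on_subset[OF continuous_on_to_verts e]])
    show "(to_verts \<circ> to_edges) ` realization C \<subseteq> realization C"
      using v e by fastforce
    show "\<exists>v. 0 < (to_verts \<circ> to_edges) p v \<and> 0 < id p v" if "p \<in> realization C" for p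
      using to_verts_to_edges_meets[OF that] by (simp only: o_apply id_apply)
  qed (simp_all only: image_id id_apply subset_refl continuous_on_id')
qed

end

theorem theorem5p2:
  fixes G :: "'a sgraph"
  assumes "finite_graph G"
    and "simple_graph G"
    and "connected_graph G"
    and "edges G \<noteq> {}"
  shows "realization (clique_complex (line_graph G)) homotopy_eqv
         realization (skeleton 2 (clique_complex G))"
proof -
  interpret nonempty_connected_graph G
    using assms by unfold_locales
  show ?thesis
    by (rule realizations_homotopy_eqv)
qed

end
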